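(* Let $X$ be a locally compact second countable space, $\alpha\in(0,1]$, and let $\Phi$ be a discrete $\alpha$-stable point process on $X$ with spectral measure $\sigma$. Then for every relatively compact Borel set $B\subset X$ and every $s\in(0,1]$, $$\mathbf{E}s^{\Phi(B)}=\exp\Bigl\{-(1-s)^\alpha\int_{\mathbb{S}}\mu(B)^\alpha\,\sigma(d\mu)\Bigr\},$$ so that for $0<\alpha<1$ the random variable $\Phi(B)$ is either zero almost surely or has infinite expectation, while $\mathbf{E}\Phi(B)$ is finite for $\alpha=1$. Furthermore, the avoidance (void) probability is given by $$\mathbf{P}\{\Phi(B)=0\}=\exp\Bigl\{-\int_{\mathbb{S}}\mu(B)^\alpha\,\sigma(d\mu)\Bigr\}.$$
   Context: $X$ is a locally compact second countable (Hausdorff) space with its Borel $\sigma$-algebra. $\mathbb{M}$ is the space of (non-negative) Radon measures on $X$ (finite on relatively compact Borel sets), with the $\sigma$-algebra generated by evaluations on Borel sets. A point process is a random element of $\mathbb{M}$ whose realisations are locally finite counting measures (multiple points allowed). $\mathrm{BM}(X)$ is the set of non-negative bounded measurable functions on $X$ with compact support; $\langle h,\mu\rangle=\int_X h\,d\mu$. Thinning: for $t\in[0,1]$, $t\circ\Phi$ is obtained by retaining each unit mass of $\Phi$ with probability $t$ and removing it with probability $1-t$, independently of the other masses. $\Phi$ is discrete $\alpha$-stable if $t^{1/\alpha}\circ\Phi'+(1-t)^{1/\alpha}\circ\Phi''\overset{\mathcal D}{=}\Phi$ for all $t\in[0,1]$, where $\Phi',\Phi''$ are independent copies of $\Phi$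 (and the two thinnings are independent). Sphere $\mathbb{S}$: fix a countable base $B_1,B_2,\dots$ of the topology of $X$ consisting of relatively compact sets and put $B_0=X$. For $\mu\in\mathbb{M}\setminus\{0\}$ let $i(\mu)$ be the smallest $i\ge0$ with $0<\mu(B_i)<\infty$, and let $\mathbb{S}=\{\mu\in\mathbb{M}\setminus\{0\}:\mu(B_{i(\mu)})=1\}$. Spectral measure: a measure $\sigma$ on $\mathbb{S}$ with $\int_{\mathbb{S}}\mu(B)^\alpha\sigma(d\mu)<\infty$ for all relatively compact Borel $B$ is a spectral measure of the discrete $\alpha$-stable process $\Phi$ if its probability generating functional is $$G_\Phi[u]=\mathbf{E}\exp\{\langle\log u,\Phi\rangle\}=\exp\Bigl\{-\int_{\mathbb{S}}\langle1-u,\mu\rangle^\alpha\sigma(d\mu)\Bigr\}$$ for all measurable $u:X\to(0,1]$ with $1-u\in\mathrm{BM}(X)$; every discrete $\alpha$-stable process has one. *)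

theory Defs
  imports "HOL-Probability.Probability"
begin

definition relatively_compact :: "'a::topological_space set \<Rightarrow> bool" where
  "relatively_compact B \<longleftrightarrow> compact (closure B)"

definition radon_measures :: "'a::topological_space measure set" where
  "radon_measures = {\<mu>. sets \<mu> = sets borel \<and>
     (\<forall>B\<in>sets borel. relatively_compact B \<longrightarrow> emeasure \<mu> B < \<infinity>)}"

definition radon_space :: "'a::topological_space measure measure" where
  "radon_space = sigma radon_measures
     {{\<mu> \<in> radon_measures. emeasure \<mu> B \<in> A} | B A. B \<in> sets borel \<and> A \<in> sets borel}"

definition counting_measures :: "'a::topological_space measure set" where
  "counting_measures = {\<mu> \<in> radon_measures.
     \<forall>B\<in>sets borel. relatively_compact B \<longrightarrow> (\<exists>n::nat. emeasure \<mu> B = of_nat n)}"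

definition counting_space :: "'a::topological_space measure measure" where
  "counting_space = restrict_space radon_space counting_measures"

definition point_process :: "'w measure \<Rightarrow> ('w \<Rightarrow> 'a::topological_space measure) \<Rightarrow> bool" where
  "point_process P \<Phi> \<longleftrightarrow> prob_space P \<and> \<Phi> \<in> P \<rightarrow>\<^sub>M radon_space \<and>
     (\<forall>\<omega>\<in>space P. \<Phi> \<omega> \<in> counting_measures)"

text \<open>The unit masses of a counting measure: an atom \<open>x\<close> of multiplicity \<open>m\<close> contributes the
  pairs \<open>(x, 0), \<dots>, (x, m - 1)\<close>, so that distinct masses at one point are thinned separately.\<close>

definition unit_masses :: "'a::topological_space measure \<Rightarrow> ('a \<times> nat) set" where
  "unit_masses \<mu> = {(x, j). of_nat j < emeasure \<mu> {x}}"

definition retained :: "'a::topological_space measure \<Rightarrow> ('a \<times> nat \<Rightarrow> bool) \<Rightarrow> 'a measure" where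
  "retained \<mu> \<epsilon> = distr (count_space {p \<in> unit_masses \<mu>. \<epsilon> p}) borel fst"

text \<open>\<open>thin t \<mu>\<close> is the law of the thinning of a fixed counting measure \<open>\<mu>\<close>;
  \<open>thin_law t L\<close> is the law of the thinning of a point process with law \<open>L\<close>.\<close>

definition thin :: "real \<Rightarrow> 'a::topological_space measure \<Rightarrow> 'a measure measure" where
  "thin t \<mu> = distr (Pi\<^sub>M (unit_masses \<mu>) (\<lambda>_. measure_pmf (bernoulli_pmf t)))
     counting_space (retained \<mu>)"

definition thin_law :: "real \<Rightarrow> 'a::topological_space measure measure \<Rightarrow> 'a measure measure" where
  "thin_law t L = L \<bind> thin t"

definition measure_add :: "'a::topological_space measure \<Rightarrow> 'a measure \<Rightarrow> 'a measure" where
  "measure_add \<mu> \<nu> = measure_of UNIV (sets borel) (\<lambda>B. emeasure \<mu> B + emeasure \<nu> B)"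

definition process_law :: "'w measure \<Rightarrow> ('w \<Rightarrow> 'a::topological_space measure) \<Rightarrow> 'a measure measure" where
  "process_law P \<Phi> = distr P counting_space \<Phi>"

text \<open>Stability is a condition on the law only: the superposition of the thinnings of two
  independent copies is the image of a product measure under addition.\<close>

definition discrete_stable ::
  "real \<Rightarrow> 'w measure \<Rightarrow> ('w \<Rightarrow> 'a::topological_space measure) \<Rightarrow> bool" where
  "discrete_stable \<alpha> P \<Phi> \<longleftrightarrow> point_process P \<Phi> \<and>
     (\<forall>t\<in>{0..1}.
        distr (thin_law (t powr (1 / \<alpha>)) (process_law P \<Phi>) \<Otimes>\<^sub>M
               thin_law ((1 - t) powr (1 / \<alpha>)) (process_law P \<Phi>))
          counting_space (\<lambda>(\<mu>, \<nu>). measure_add \<mu> \<nu>)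
        = process_law P \<Phi>)"

definition BM :: "('a::topological_space \<Rightarrow> real) set" where
  "BM = {h \<in> borel_measurable borel. (\<forall>x. 0 \<le> h x) \<and> bounded (range h) \<and>
     compact (closure {x. h x \<noteq> 0})}"

text \<open>The base is \<open>b 1, b 2, \<dots>\<close>; index \<open>0\<close> is reserved for the whole space.\<close>

definition sphere_base :: "(nat \<Rightarrow> 'a::topological_space set) \<Rightarrow> bool" where
  "sphere_base b \<longleftrightarrow> b 0 = UNIV \<and> topological_basis (b ` {1..}) \<and>
     (\<forall>i\<ge>1. relatively_compact (b i))"

definition sphere_index :: "(nat \<Rightarrow> 'a::topological_space set) \<Rightarrow> 'a measure \<Rightarrow> nat" where
  "sphere_index b \<mu> = (LEAST i. 0 < emeasure \<mu> (b i) \<and> emeasure \<mu> (b i) < \<infinity>)"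

definition radon_sphere :: "(nat \<Rightarrow> 'a::topological_space set) \<Rightarrow> 'a measure set" where
  "radon_sphere b = {\<mu> \<in> radon_measures - {null_measure borel}.
     emeasure \<mu> (b (sphere_index b \<mu>)) = 1}"

definition pgfl ::
  "'w measure \<Rightarrow> ('w \<Rightarrow> 'a::topological_space measure) \<Rightarrow> ('a \<Rightarrow> real) \<Rightarrow> real" where
  "pgfl P \<Phi> u = (\<integral>\<omega>. exp (\<integral>x. ln (u x) \<partial>\<Phi> \<omega>) \<partial>P)"

definition spectral_measure ::
  "(nat \<Rightarrow> 'a::topological_space set) \<Rightarrow> real \<Rightarrow> 'w measure \<Rightarrow> ('w \<Rightarrow> 'a measure) \<Rightarrow>
     'a measure measure \<Rightarrow> bool" where
  "spectral_measure b \<alpha> P \<Phi> \<sigma> \<longleftrightarrow>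
     space \<sigma> = radon_sphere b \<and>
     sets \<sigma> = sets (restrict_space radon_space (radon_sphere b)) \<and>
     (\<forall>B\<in>sets borel. relatively_compact B \<longrightarrow>
        (\<integral>\<^sup>+\<mu>. ennreal (measure \<mu> B powr \<alpha>) \<partial>\<sigma>) < \<infinity>) \<and>
     (\<forall>u\<in>borel_measurable borel. (\<forall>x. 0 < u x \<and> u x \<le> 1) \<longrightarrow> (\<lambda>x. 1 - u x) \<in> BM \<longrightarrow>
        pgfl P \<Phi> u = exp (- (\<integral>\<mu>. (\<integral>x. 1 - u x \<partial>\<mu>) powr \<alpha> \<partial>\<sigma>)))"

end

(* Testing the generating functional on u = s on B, u = 1 off B yields the generating function
   of the count N = \<Phi>(B), namely E s^N = exp (-(1-s)^\<alpha> c).  Then s -> 0 gives the void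
   probability, and (1 - E s^N) / (1 - s) = E (1 + s + ... + s^(N-1)) increases to E N as s -> 1:
   it stays below c when \<alpha> = 1, and is unbounded when \<alpha> < 1 and c > 0. *)

theory Submission
  imports Defs "HOL-Real_Asymp.Real_Asymp"
begin

section \<open>Generating functions of integer-valued random variables near 0 and near 1\<close>

lemma (in prob_space) integrable_power_count:
  fixes X :: "'a \<Rightarrow> nat" and s :: real
  assumes [measurable]: "X \<in> M \<rightarrow>\<^sub>M count_space UNIV" and "0 \<le> s" "s \<le> 1"
  shows "integrable M (\<lambda>\<omega>. s ^ X \<omega>)"
proof (rule integrable_const_bound[where B=1])
  show "AE \<omega> in M. norm (s ^ X \<omega>) \<le> 1"
    using assms by (simp add: power_le_one)
qed measurable

text \<open>As s tends to 0, s^N tends to 0 if N > 0 and stays 1 if N = 0 (the convention 0^0 = 1);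
  dominated convergence with bound 1 applies. The points \<open>1 / real (n + 2)\<close> lie
  strictly inside (0,1), where the stable formula will be available.\<close>

lemma (in prob_space) pgf_tendsto_void:
  fixes X :: "'a \<Rightarrow> nat"
  assumes [measurable]: "X \<in> M \<rightarrow>\<^sub>M count_space UNIV"
  shows "(\<lambda>n. expectation (\<lambda>\<omega>. (1 / real (n + 2)) ^ X \<omega>)) \<longlonglongrightarrow> prob {\<omega> \<in> space M. X \<omega> = 0}"
proof -
  let ?A = "{\<omega> \<in> space M. X \<omega> = 0}"
  have "(\<lambda>n. expectation (\<lambda>\<omega>. (1 / real (n + 2)) ^ X \<omega>)) \<longlonglongrightarrow> expectation (indicator ?A)"
  proof (rule integral_dominated_convergence[where w="\<lambda>_. 1"])
    show "AE \<omega> in M. (\<lambda>n. (1 / real (n + 2)) ^ X \<omega>) \<longlonglongrightarrow> indicator ?A \<omega>"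
    proof (rule AE_I2)
      fix \<omega> assume \<omega>: "\<omega> \<in> space M"
      have "(\<lambda>n. 1 / real (n + 2)) \<longlonglongrightarrow> 0"
        by real_asymp
      from tendsto_power[OF this, of "X \<omega>"]
      show "(\<lambda>n. (1 / real (n + 2)) ^ X \<omega>) \<longlonglongrightarrow> indicator ?A \<omega>"
        using \<omega> by (cases "X \<omega> = 0") (auto simp: indicator_def power_0_left)
    qed
    show "AE \<omega> in M. norm ((1 / real (n + 2)) ^ X \<omega>) \<le> 1" for n
      by (intro AE_I2) (simp add: power_le_one)
  qed auto
  then show ?thesis
    by simp
qed

text \<open>The geometric sum equals (1 - s^N)/(1 - s) pointwise, and s^N is integrable, so
  expectations may be taken in the numerator.\<close>

lemma (in prob_space) pgf_difference_quotient:
  fixes X :: "'a \<Rightarrow> nat" and s :: real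
  assumes [measurable]: "X \<in> M \<rightarrow>\<^sub>M count_space UNIV" and "0 < s" "s < 1"
  shows "(\<integral>\<^sup>+\<omega>. ennreal (\<Sum>i<X \<omega>. s ^ i) \<partial>M)
           = ennreal ((1 - expectation (\<lambda>\<omega>. s ^ X \<omega>)) / (1 - s))"
proof -
  have eq: "(\<Sum>i<n. s ^ i) = (1 - s ^ n) / (1 - s)" for n
    using assms by (simp add: sum_gp_strict)
  have int: "integrable M (\<lambda>\<omega>. s ^ X \<omega>)"
    using assms by (intro integrable_power_count) auto
  show ?thesis
    unfolding eq using assms int
    by (subst nn_integral_eq_integral)
       (auto simp: prob_space power_le_one)
qed

text \<open>Each of the N terms of the geometric sum is at most 1. Hence a finite mean bounds all
  difference quotients at once, which is how an infinite mean is detected later.\<close>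

lemma (in prob_space) pgf_difference_quotient_le:
  fixes X :: "'a \<Rightarrow> nat" and s :: real
  assumes "X \<in> M \<rightarrow>\<^sub>M count_space UNIV" and "0 < s" "s < 1"
  shows "ennreal ((1 - expectation (\<lambda>\<omega>. s ^ X \<omega>)) / (1 - s)) \<le> (\<integral>\<^sup>+\<omega>. of_nat (X \<omega>) \<partial>M)"
proof -
  have "(\<Sum>i<n. s ^ i) \<le> real n" for n
    using sum_bounded_above[of "{..<n}" "\<lambda>i. s ^ i" 1] assms by (simp add: power_le_one)
  then show ?thesis
    unfolding pgf_difference_quotient[OF assms, symmetric] ennreal_of_nat_eq_real_of_nat
    by (intro nn_integral_mono ennreal_leI) auto
qed

text \<open>A converse to the previous bound: the geometric sums tend to N along a sequence s -> 1,
  and Fatou's lemma carries a uniform bound on the quotients over to the mean.\<close>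

lemma (in prob_space) nn_integral_count_le_of_pgf:
  fixes X :: "'a \<Rightarrow> nat" and c :: real
  assumes [measurable]: "X \<in> M \<rightarrow>\<^sub>M count_space UNIV"
    and pgf: "\<And>s. 0 < s \<Longrightarrow> s < 1 \<Longrightarrow> (1 - expectation (\<lambda>\<omega>. s ^ X \<omega>)) / (1 - s) \<le> c"
  shows "(\<integral>\<^sup>+\<omega>. of_nat (X \<omega>) \<partial>M) \<le> ennreal c"
proof -
  define s :: "nat \<Rightarrow> real" where "s n = 1 - 1 / real (n + 2)" for n
  have s: "0 < s n" "s n < 1" for n
    by (auto simp: s_def field_simps)
  have "s \<longlonglongrightarrow> 1"
    unfolding s_def by real_asymp
  then have "(\<lambda>n. ennreal (\<Sum>i<k. s n ^ i)) \<longlonglongrightarrow> ennreal (\<Sum>i<k. 1 ^ i)" for k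
    by (intro tendsto_ennrealI tendsto_sum tendsto_power)
  then have lim: "liminf (\<lambda>n. ennreal (\<Sum>i<k. s n ^ i)) = of_nat k" for k
    by (intro lim_imp_Liminf) (auto simp: ennreal_of_nat_eq_real_of_nat)
  \<comment> \<open>Writing N pointwise as the liminf of its geometric sums makes this exactly
    Fatou's lemma.\<close>
  have "(\<integral>\<^sup>+\<omega>. of_nat (X \<omega>) \<partial>M) \<le> liminf (\<lambda>n. \<integral>\<^sup>+\<omega>. ennreal (\<Sum>i<X \<omega>. s n ^ i) \<partial>M)"
    unfolding lim[symmetric] by (rule nn_integral_liminf) measurable
  also have "\<dots> \<le> liminf (\<lambda>n::nat. ennreal c)"
    by (intro Liminf_mono always_eventually allI)
       (subst pgf_difference_quotient, use s pgf in \<open>auto intro!: ennreal_leI\<close>)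
  also have "\<dots> = ennreal c"
    by (simp add: Liminf_const)
  finally show ?thesis .
qed

section \<open>Void probability and mean under the stable generating function\<close>

lemma (in prob_space) stable_pgf_void:
  fixes X :: "'a \<Rightarrow> nat" and \<alpha> c :: real
  assumes "X \<in> M \<rightarrow>\<^sub>M count_space UNIV"
    and pgf: "\<And>s. 0 < s \<Longrightarrow> s < 1 \<Longrightarrow>
           expectation (\<lambda>\<omega>. s ^ X \<omega>) = exp (- ((1 - s) powr \<alpha> * c))"
  shows "prob {\<omega> \<in> space M. X \<omega> = 0} = exp (- c)"
proof -
  \<comment> \<open>With s = 1/(n + 2), the base 1 - s tends to 1, where \<open>powr\<close> is
    continuous; both limits of the generating function at 0 are then compared.\<close>
  have "(\<lambda>n. 1 - 1 / real (n + 2)) \<longlonglongrightarrow> 1"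
    by real_asymp
  then have "(\<lambda>n. exp (- ((1 - 1 / real (n + 2)) powr \<alpha> * c))) \<longlonglongrightarrow> exp (- (1 powr \<alpha> * c))"
    by (intro tendsto_intros) auto
  then have "(\<lambda>n. expectation (\<lambda>\<omega>. (1 / real (n + 2)) ^ X \<omega>)) \<longlonglongrightarrow> exp (- c)"
    by (subst pgf) auto
  with pgf_tendsto_void[OF assms(1)] show ?thesis
    by (rule LIMSEQ_unique)
qed

text \<open>The inequality 1 - exp(-x) \<le> x at x = (1 - s) c bounds every difference quotient by
  c. The exponent is written \<open>powr 1\<close> to match the stable formula at \<alpha> =
  1.\<close>

lemma (in prob_space) stable_pgf_finite_mean:
  fixes X :: "'a \<Rightarrow> nat" and c :: real
  assumes "X \<in> M \<rightarrow>\<^sub>M count_space UNIV"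
    and pgf: "\<And>s. 0 < s \<Longrightarrow> s < 1 \<Longrightarrow>
           expectation (\<lambda>\<omega>. s ^ X \<omega>) = exp (- ((1 - s) powr 1 * c))"
  shows "(\<integral>\<^sup>+\<omega>. of_nat (X \<omega>) \<partial>M) < \<infinity>"
proof -
  have "(1 - expectation (\<lambda>\<omega>. s ^ X \<omega>)) / (1 - s) \<le> c" if "0 < s" "s < 1" for s
    using that exp_ge_add_one_self[of "- ((1 - s) * c)"]
    by (simp add: pgf pos_divide_le_eq mult.commute)
  then have "(\<integral>\<^sup>+\<omega>. of_nat (X \<omega>) \<partial>M) \<le> ennreal c"
    by (rule nn_integral_count_le_of_pgf[OF assms(1)])
  then show ?thesis
    using ennreal_less_top[of c] by (simp add: order_le_less_trans)
qed

text \<open>With h = 1 - s, the difference quotient behaves like c h^(\<alpha> - 1) as h decreases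
  to 0. This blows up since \<alpha> < 1, whereas a finite mean m would bound it.\<close>

lemma (in prob_space) stable_pgf_infinite_mean:
  fixes X :: "'a \<Rightarrow> nat" and \<alpha> c :: real
  assumes "X \<in> M \<rightarrow>\<^sub>M count_space UNIV"
    and pgf: "\<And>s. 0 < s \<Longrightarrow> s < 1 \<Longrightarrow>
           expectation (\<lambda>\<omega>. s ^ X \<omega>) = exp (- ((1 - s) powr \<alpha> * c))"
    and "0 < \<alpha>" "\<alpha> < 1" "0 < c"
  shows "(\<integral>\<^sup>+\<omega>. of_nat (X \<omega>) \<partial>M) = \<infinity>"
proof (rule ccontr)
  assume "(\<integral>\<^sup>+\<omega>. of_nat (X \<omega>) \<partial>M) \<noteq> \<infinity>"
  then obtain m where m: "0 \<le> m" "(\<integral>\<^sup>+\<omega>. of_nat (X \<omega>) \<partial>M) = ennreal m"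
    by (metis ennreal_cases infinity_ennreal_def)
  have bound: "(1 - exp (- (h powr \<alpha> * c))) / h \<le> m" if "0 < h" "h < 1" for h
    using pgf_difference_quotient_le[OF assms(1), of "1 - h"] that m by (simp add: pgf)
  have "filterlim (\<lambda>h. (1 - exp (- (h powr \<alpha> * c))) / h) at_top (at_right 0)"
    using assms(3-5) by real_asymp
  then have "\<forall>\<^sub>F h in at_right 0. m < (1 - exp (- (h powr \<alpha> * c))) / h"
    by (auto simp: filterlim_at_top_dense)
  \<comment> \<open>Restricting to 0 < h < 1 makes \<open>bound\<close> applicable; since
    \<open>at_right 0\<close> is a nontrivial filter, an eventually false statement is a
    contradiction.\<close>
  moreover have "\<forall>\<^sub>F h::real in at_right 0. h \<in> {0<..<1}"
    by (rule eventually_at_right_real) simp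
  ultimately have "\<forall>\<^sub>F h::real in at_right 0. False"
    by eventually_elim (use bound in force)
  then show False
    by simp
qed

section \<open>From the generating functional to the count of a set\<close>

lemma measurable_emeasure_radon_space:
  assumes "B \<in> sets (borel :: 'a::topological_space measure)"
  shows "(\<lambda>\<mu>. emeasure \<mu> B) \<in> borel_measurable (radon_space :: 'a measure measure)"
proof (rule measurableI)
  fix A :: "ennreal set" assume A: "A \<in> sets borel"
  let ?E = "{{\<mu> \<in> radon_measures. emeasure \<mu> B \<in> A} | B A.
     B \<in> sets (borel :: 'a measure) \<and> A \<in> sets borel}"
  \<comment> \<open>The sets of \<open>sigma\<close> are the generated ones only if the generators
    are subsets of the base space, so this inclusion comes first.\<close>
  have "?E \<subseteq> Pow radon_measures"
    by auto
  then have *: "space (radon_space :: 'a measure measure) = radon_measures"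
    "sets (radon_space :: 'a measure measure) = sigma_sets radon_measures ?E"
    by (simp_all add: radon_space_def)
  have "(\<lambda>\<mu>. emeasure \<mu> B) -` A \<inter> space radon_space = {\<mu> \<in> radon_measures. emeasure \<mu> B \<in> A}"
    using * by auto
  also have "\<dots> \<in> sets radon_space"
    unfolding *(2) using assms A by (intro sigma_sets.Basic) blast
  finally show "(\<lambda>\<mu>. emeasure \<mu> B) -` A \<inter> space radon_space \<in> sets radon_space" .
qed simp

text \<open>The test function is s on B and 1 elsewhere, so its logarithm is \<open>ln s\<close>
  times the indicator of B, with integral \<open>ln s\<close> times the mass of B.\<close>

lemma pgfl_indicator:
  fixes \<Phi> :: "'w \<Rightarrow> 'a::topological_space measure"
  assumes "point_process P \<Phi>" "B \<in> sets borel" "0 < s"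
  shows "pgfl P \<Phi> (\<lambda>x. 1 - (1 - s) * indicator B x) = (\<integral>\<omega>. s powr measure (\<Phi> \<omega>) B \<partial>P)"
  unfolding pgfl_def
proof (rule Bochner_Integration.integral_cong[OF refl])
  fix \<omega> assume "\<omega> \<in> space P"
  then have "sets (\<Phi> \<omega>) = sets borel"
    using assms(1) by (auto simp: point_process_def counting_measures_def radon_measures_def)
  moreover from this have "space (\<Phi> \<omega>) = UNIV"
    by (metis sets_eq_imp_space_eq space_borel)
  moreover have "(\<lambda>x. ln (1 - (1 - s) * indicator B x)) = (\<lambda>x. ln s * indicator B x)"
    by (auto simp: indicator_def)
  ultimately show "exp (\<integral>x. ln (1 - (1 - s) * indicator B x) \<partial>\<Phi> \<omega>) = s powr measure (\<Phi> \<omega>) B"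
    using assms by (simp add: powr_def mult.commute)
qed

lemma BM_indicator:
  assumes "B \<in> sets borel" "relatively_compact B" "0 \<le> a"
  shows "(\<lambda>x. a * indicator B x) \<in> BM"
proof -
  \<comment> \<open>The lemma is used with a = 1 - s, which vanishes at s = 1; the support is then
    empty.\<close>
  have "{x. a * indicator B x \<noteq> 0} = (if a = 0 then {} else B)"
    by (auto simp: indicator_def)
  moreover have "bounded (range (\<lambda>x. a * indicator B x))"
    by (rule bounded_subset[of "{0, a}"]) (auto simp: indicator_def)
  ultimately show ?thesis
    using assms by (auto simp: BM_def relatively_compact_def)
qed

text \<open>For the step function u, the pairing of 1 - u with \<mu> is (1 - s) \<mu>(B), and the
  factor (1 - s)^\<alpha> leaves the spectral integral. At s = 1 both sides are 1, as
  \<open>0 powr \<alpha> = 0\<close>.\<close>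

lemma spectral_measure_pgf_count:
  fixes \<Phi> :: "'w \<Rightarrow> 'a::topological_space measure"
  assumes "point_process P \<Phi>" and spec: "spectral_measure b \<alpha> P \<Phi> \<sigma>"
    and B: "B \<in> sets borel" "relatively_compact B" and s: "0 < s" "s \<le> 1"
  shows "(\<integral>\<omega>. s powr measure (\<Phi> \<omega>) B \<partial>P)
           = exp (- ((1 - s) powr \<alpha> * (\<integral>\<mu>. measure \<mu> B powr \<alpha> \<partial>\<sigma>)))"
proof -
  define u :: "'a \<Rightarrow> real" where "u x = 1 - (1 - s) * indicator B x" for x
  have "(\<integral>\<mu>. (\<integral>x. 1 - u x \<partial>\<mu>) powr \<alpha> \<partial>\<sigma>) = (\<integral>\<mu>. (1 - s) powr \<alpha> * measure \<mu> B powr \<alpha> \<partial>\<sigma>)"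
  proof (rule Bochner_Integration.integral_cong[OF refl])
    fix \<mu> assume "\<mu> \<in> space \<sigma>"
    then have "sets \<mu> = sets borel"
      using spec by (auto simp: spectral_measure_def radon_sphere_def radon_measures_def)
    moreover from this have "space \<mu> = UNIV"
      by (metis sets_eq_imp_space_eq space_borel)
    ultimately show "(\<integral>x. 1 - u x \<partial>\<mu>) powr \<alpha> = (1 - s) powr \<alpha> * measure \<mu> B powr \<alpha>"
      using s by (simp add: u_def powr_mult)
  qed
  also have "\<dots> = (1 - s) powr \<alpha> * (\<integral>\<mu>. measure \<mu> B powr \<alpha> \<partial>\<sigma>)"
    by simp
  finally have rhs: "(\<integral>\<mu>. (\<integral>x. 1 - u x \<partial>\<mu>) powr \<alpha> \<partial>\<sigma>)
      = (1 - s) powr \<alpha> * (\<integral>\<mu>. measure \<mu> B powr \<alpha> \<partial>\<sigma>)" .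
  have "u \<in> borel_measurable borel"
    unfolding u_def using B by measurable
  moreover have "0 < u x \<and> u x \<le> 1" for x
    using s by (auto simp: u_def indicator_def)
  moreover have "(\<lambda>x. 1 - u x) \<in> BM"
    unfolding u_def using BM_indicator[OF B, of "1 - s"] s by simp
  ultimately have "pgfl P \<Phi> u = exp (- (\<integral>\<mu>. (\<integral>x. 1 - u x \<partial>\<mu>) powr \<alpha> \<partial>\<sigma>))"
    using spec by (simp add: spectral_measure_def)
  with pgfl_indicator[OF assms(1) B(1) s(1)] show ?thesis
    unfolding rhs by (simp add: u_def[abs_def])
qed

text \<open>Supplies the count as a measurable natural-valued variable, the form in which the
  generating function lemmas take it. The floor is a measurable map into the naturals and is exact
  because the realisations are counting measures.\<close>

lemma point_process_count:
  fixes \<Phi> :: "'w \<Rightarrow> 'a::topological_space measure"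
  assumes "point_process P \<Phi>" and B: "B \<in> sets borel" "relatively_compact B"
  obtains X :: "'w \<Rightarrow> nat" where "X \<in> P \<rightarrow>\<^sub>M count_space UNIV"
    and "\<And>\<omega>. \<omega> \<in> space P \<Longrightarrow> emeasure (\<Phi> \<omega>) B = of_nat (X \<omega>)"
proof
  let ?X = "\<lambda>\<omega>. nat \<lfloor>enn2real (emeasure (\<Phi> \<omega>) B)\<rfloor>"
  have [measurable]: "(\<lambda>\<omega>. emeasure (\<Phi> \<omega>) B) \<in> borel_measurable P"
    using assms(1) measurable_emeasure_radon_space[OF B(1)]
    by (auto simp: point_process_def intro: measurable_compose)
  show "?X \<in> P \<rightarrow>\<^sub>M count_space UNIV"
    by measurable
  show "emeasure (\<Phi> \<omega>) B = of_nat (?X \<omega>)" if \<omega>: "\<omega> \<in> space P" for \<omega>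
  proof -
    obtain n :: nat where "emeasure (\<Phi> \<omega>) B = of_nat n"
      using assms \<omega> by (auto simp: point_process_def counting_measures_def)
    then show ?thesis
      by (simp add: ennreal_of_nat_eq_real_of_nat)
  qed
qed

section \<open>Generating function, mean and void probability of the count of B\<close>

theorem mainTheorem9:
  fixes P :: "'w measure"
    and \<Phi> :: "'w \<Rightarrow> 'a::{t2_space, second_countable_topology} measure"
    and \<sigma> :: "'a measure measure"
    and b :: "nat \<Rightarrow> 'a set"
    and \<alpha> :: real
    and B :: "'a set"
  assumes "locally_compact_space (euclidean :: 'a topology)"
    and "0 < \<alpha>" and "\<alpha> \<le> 1"
    and "sphere_base b"
    and "discrete_stable \<alpha> P \<Phi>"
    and "spectral_measure b \<alpha> P \<Phi> \<sigma>"
    and "B \<in> sets borel" and "relatively_compact B"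
  shows "(\<forall>s\<in>{0<..1}. (\<integral>\<omega>. s powr measure (\<Phi> \<omega>) B \<partial>P)
            = exp (- ((1 - s) powr \<alpha> * (\<integral>\<mu>. measure \<mu> B powr \<alpha> \<partial>\<sigma>))))
       \<and> (\<alpha> < 1 \<longrightarrow> (AE \<omega> in P. emeasure (\<Phi> \<omega>) B = 0) \<or> (\<integral>\<^sup>+\<omega>. emeasure (\<Phi> \<omega>) B \<partial>P) = \<infinity>)
       \<and> (\<alpha> = 1 \<longrightarrow> (\<integral>\<^sup>+\<omega>. emeasure (\<Phi> \<omega>) B \<partial>P) < \<infinity>)
       \<and> measure P {\<omega> \<in> space P. emeasure (\<Phi> \<omega>) B = 0}
            = exp (- (\<integral>\<mu>. measure \<mu> B powr \<alpha> \<partial>\<sigma>))"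
proof -
  let ?c = "\<integral>\<mu>. measure \<mu> B powr \<alpha> \<partial>\<sigma>"
  have pp: "point_process P \<Phi>"
    using assms(5) by (simp add: discrete_stable_def)
  then interpret prob_space P
    by (simp add: point_process_def)
  obtain X :: "'w \<Rightarrow> nat" where X [measurable]: "X \<in> P \<rightarrow>\<^sub>M count_space UNIV"
    and count: "\<And>\<omega>. \<omega> \<in> space P \<Longrightarrow> emeasure (\<Phi> \<omega>) B = of_nat (X \<omega>)"
    using point_process_count[OF pp assms(7,8)] by blast
  have meas: "measure (\<Phi> \<omega>) B = real (X \<omega>)" if "\<omega> \<in> space P" for \<omega>
    using count[OF that] by (simp add: measure_def ennreal_of_nat_eq_real_of_nat)
  have pgf_powr: "(\<integral>\<omega>. s powr measure (\<Phi> \<omega>) B \<partial>P) = exp (- ((1 - s) powr \<alpha> * ?c))"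
    if "0 < s" "s \<le> 1" for s
    using spectral_measure_pgf_count[OF pp assms(6-8) that] .
  \<comment> \<open>For s > 0 real and natural powers agree, which passes from the mass of B to the
    integer count.\<close>
  have pgf: "expectation (\<lambda>\<omega>. s ^ X \<omega>) = exp (- ((1 - s) powr \<alpha> * ?c))"
    if "0 < s" "s < 1" for s
  proof -
    have "expectation (\<lambda>\<omega>. s ^ X \<omega>) = (\<integral>\<omega>. s powr measure (\<Phi> \<omega>) B \<partial>P)"
      using that by (intro Bochner_Integration.integral_cong) (auto simp: meas powr_realpow)
    with pgf_powr that show ?thesis
      by simp
  qed
  have mean: "(\<integral>\<^sup>+\<omega>. emeasure (\<Phi> \<omega>) B \<partial>P) = (\<integral>\<^sup>+\<omega>. of_nat (X \<omega>) \<partial>P)"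
    by (intro nn_integral_cong count)
  have void_eq: "{\<omega> \<in> space P. emeasure (\<Phi> \<omega>) B = 0} = {\<omega> \<in> space P. X \<omega> = 0}"
    by (auto simp: count)
  have void: "prob {\<omega> \<in> space P. X \<omega> = 0} = exp (- ?c)"
    by (rule stable_pgf_void[OF X pgf])
  have "(AE \<omega> in P. emeasure (\<Phi> \<omega>) B = 0) \<or> (\<integral>\<^sup>+\<omega>. emeasure (\<Phi> \<omega>) B \<partial>P) = \<infinity>" if "\<alpha> < 1"
  \<comment> \<open>The dichotomy is governed by the spectral integral: if it is 0, the void
    probability is exp(0) = 1 and the count vanishes almost surely; otherwise it is positive, its
    integrand being non-negative, and the mean is infinite.\<close>
  proof (cases "?c = 0")
    case True
    with void have "AE \<omega> in P. X \<omega> = 0"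
      by (subst prob_Collect_eq_1[symmetric]) auto
    moreover have "AE \<omega> in P. emeasure (\<Phi> \<omega>) B = of_nat (X \<omega>)"
      by (intro AE_I2 count)
    ultimately have "AE \<omega> in P. emeasure (\<Phi> \<omega>) B = 0"
      by eventually_elim simp
    then show ?thesis ..
  next
    case False
    then have "0 < ?c"
      by (simp add: order_less_le)
    with stable_pgf_infinite_mean[OF X pgf \<open>0 < \<alpha>\<close> that] show ?thesis
      by (simp add: mean)
  qed
  moreover have "(\<integral>\<^sup>+\<omega>. emeasure (\<Phi> \<omega>) B \<partial>P) < \<infinity>" if "\<alpha> = 1"
    using stable_pgf_finite_mean[OF X, of ?c] pgf that by (simp add: mean)
  ultimately show ?thesis
    using pgf_powr void by (simp add: void_eq)
qed

end
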